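(* Let $X=(V,E)$ be any digraph with vertices labeled $v_1,v_2,\ldots,v_n$ and let $e=(v_{n-1},v_n)$ be an edge of $X$. Then $$W_X=W_{X\setminus e}-W_{X/e}\uparrow,$$ where the vertices of $X\setminus e$ are labeled as in $X$, and the vertices of $X/e$ are labeled $v_1,\ldots,v_{n-2},v_{n-1}$ with the vertex obtained by the contraction labeled $v_{n-1}$ and the remaining vertices keeping their labels.
   Context: A digraph is a pair $X=(V,E)$ with $V$ a finite set and $E\subseteq V\times V$ (loops are allowed). Write $\mathbb{P}$ for the set of positive integers. If $|V|=n$, a $V$-listing is a bijection $\sigma:[n]\to V$, written $\sigma=(\sigma_1,\ldots,\sigma_n)$; $\Sigma_V$ is the set of all $V$-listings. For a coloring $f:V\to\mathbb{P}$, a $V$-listing $\sigma$ is $(f,X)$-friendly if $f(\sigma_1)\le f(\sigma_2)\le\cdots\le f(\sigma_n)$ and $f(\sigma_j)<f(\sigma_{j+1})$ for each $j\in[n-1]$ with $(\sigma_j,\sigma_{j+1})\in E$. Let $\Sigma_V(f,X)$ be the set of $(f,X)$-friendly $V$-listings. For a digraph $X$ with vertices labeled $v_1,\ldots,v_n$ in a fixed order, the Redei-Berge function in noncommuting variables is the formal power series in noncommuting variables $x_1,x_2,\ldots$ $$W_X=\sum_{f:V\to\mathbb{P}}\#\Sigma_V(f,X)\; x_{f(v_1)}x_{f(v_2)}\cdots x_{f(v_n)}.$$ Deletion: $X\setminus e=(V,E\setminus\{e\})$. Contraction of $X$ by $e=(u,v)\in E$ ($u\ne v$): $X/e=(V',E')$,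 where $V'=(V\setminus\{u,v\})\cup\{e\}$ and $E'$ consists of all edges in $E$ both of whose endpoints are different from $u,v$, together with, for $w\ne u,v$: $(w,e)\in E'$ if and only if $(w,u)\in E$, and $(e,w)\in E'$ if and only if $(v,w)\in E$ (there is no loop at $e$). The induction operation $\uparrow$ is defined on monomials of degree $n-1$ by $(x_{i_1}x_{i_2}\cdots x_{i_{n-2}}x_{i_{n-1}})\uparrow=x_{i_1}x_{i_2}\cdots x_{i_{n-2}}x_{i_{n-1}}^2$ and extended linearly (to possibly infinite sums of monomials). *)

theory Defs
  imports
    "HOL-Library.FuncSet"
    "HOL-Combinatorics.Multiset_Permutations"
    "Graph_Theory.Pair_Digraph"
begin

text \<open>
  The monomial \<open>x\<^bsub>i\<^sub>1\<^esub> \<dots> x\<^bsub>i\<^sub>k\<^esub>\<close> is the word \<open>[i\<^sub>1, \<dots>, i\<^sub>k]\<close>, and a power series in noncommuting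
  variables is its coefficient function. The variables are indexed by the positive integers:
  a word containing the letter \<open>0\<close> is not a monomial, and the series below have coefficient
  \<open>0\<close> there.
\<close>

type_synonym nc_series = "nat list \<Rightarrow> int"

text \<open>
  The possibly infinite formal sum of the terms \<open>c a * m a\<close> over \<open>a \<in> A\<close>, with \<open>m a\<close> a monomial.
  It is meaningful when each monomial occurs only finitely often, as the lemmas
  \<open>finite_colorings_of_word\<close> and \<open>finite_induct_word\<close> show for the two uses below.
\<close>

definition formal_sum :: "'i set \<Rightarrow> ('i \<Rightarrow> int) \<Rightarrow> ('i \<Rightarrow> nat list) \<Rightarrow> nc_series" where
  "formal_sum A c m = (\<lambda>w. \<Sum>a | a \<in> A \<and> m a = w. c a)"

text \<open>
  A \<open>V\<close>-listing is represented by the list of its values, i.e. by an element of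
  \<open>permutations_of_set V\<close>. List positions start at \<open>0\<close>.
\<close>

definition friendly :: "('a \<Rightarrow> nat) \<Rightarrow> 'a pair_pre_digraph \<Rightarrow> 'a list \<Rightarrow> bool" where
  "friendly f X \<sigma> \<longleftrightarrow> sorted (map f \<sigma>) \<and>
     (\<forall>j. Suc j < length \<sigma> \<longrightarrow> (\<sigma> ! j, \<sigma> ! Suc j) \<in> parcs X \<longrightarrow> f (\<sigma> ! j) < f (\<sigma> ! Suc j))"

definition friendly_listings :: "('a \<Rightarrow> nat) \<Rightarrow> 'a pair_pre_digraph \<Rightarrow> 'a list set" where
  "friendly_listings f X = {\<sigma> \<in> permutations_of_set (pverts X). friendly f X \<sigma>}"

definition colorings :: "'a set \<Rightarrow> ('a \<Rightarrow> nat) set" where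
  "colorings V = V \<rightarrow>\<^sub>E {0<..}"

text \<open>The list \<open>vs\<close> gives the labeling \<open>v\<^sub>1, \<dots>, v\<^sub>n\<close> of the vertices.\<close>

definition redei_berge :: "'a pair_pre_digraph \<Rightarrow> 'a list \<Rightarrow> nc_series" where
  "redei_berge X vs =
     formal_sum (colorings (pverts X)) (\<lambda>f. int (card (friendly_listings f X))) (\<lambda>f. map f vs)"

lemma finite_colorings_of_word:
  assumes "set vs = V"
  shows "finite {f. f \<in> colorings V \<and> map f vs = w}"
proof (rule finite_subset)
  show "{f. f \<in> colorings V \<and> map f vs = w} \<subseteq> V \<rightarrow>\<^sub>E set w"
    using assms by (auto simp: colorings_def PiE_iff extensional_def)
  show "finite (V \<rightarrow>\<^sub>E set w)"
    using assms by (auto intro: finite_PiE)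
qed

definition delete_arc :: "'a pair_pre_digraph \<Rightarrow> 'a \<times> 'a \<Rightarrow> 'a pair_pre_digraph" where
  "delete_arc X e = X\<lparr>parcs := parcs X - {e}\<rparr>"

text \<open>The vertices of \<open>X / e\<close> are the old vertices, tagged \<open>Inl\<close>, and the new vertex \<open>Inr e\<close>.\<close>

definition contract_arc ::
    "'a pair_pre_digraph \<Rightarrow> 'a \<times> 'a \<Rightarrow> ('a + 'a \<times> 'a) pair_pre_digraph" where
  "contract_arc X e = (let V = pverts X - {fst e, snd e} in
     \<lparr>pverts = Inl ` V \<union> {Inr e},
      parcs = {(Inl a, Inl b) | a b. a \<in> V \<and> b \<in> V \<and> (a, b) \<in> parcs X}
            \<union> {(Inl w, Inr e) | w. w \<in> V \<and> (w, fst e) \<in> parcs X}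
            \<union> {(Inr e, Inl w) | w. w \<in> V \<and> (snd e, w) \<in> parcs X}\<rparr>)"

text \<open>
  The induction operation repeats the last letter of each monomial. It is not defined on the
  empty monomial, so a constant term is dropped.
\<close>

definition nc_induct :: "nc_series \<Rightarrow> nc_series" where
  "nc_induct F = formal_sum {u. u \<noteq> []} F (\<lambda>u. u @ [last u])"

lemma finite_induct_word: "finite {u. u \<in> {u. u \<noteq> []} \<and> u @ [last u] = w}"
  by (rule finite_subset[of _ "{butlast w}"]) auto

end

theory Submission
  imports Defs
begin

text \<open>
  Fix a coloring \<open>f\<close>. A listing that is friendly for \<open>X \ e\<close> but not for \<open>X\<close> contains \<open>u, v\<close>
  consecutively with \<open>f u = f v\<close>. Gluing these two entries into the contracted vertex gives a
  bijection with the friendly listings of \<open>X / e\<close>, whose coloring \<open>glue_coloring\<close> gives the new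
  vertex the common color; on monomials, the induction operation restores the second copy of that
  color. Comparing coefficients proves the theorem.
\<close>

section \<open>Friendliness as a condition on consecutive entries\<close>

definition step_ok :: "('a \<Rightarrow> nat) \<Rightarrow> 'a pair_pre_digraph \<Rightarrow> 'a \<Rightarrow> 'a \<Rightarrow> bool" where
  "step_ok f X a b \<longleftrightarrow> f a \<le> f b \<and> ((a, b) \<in> parcs X \<longrightarrow> f a < f b)"

text \<open>By transitivity of \<le>, sortedness only has to be tested on neighbours. In this form
  friendliness splits along \<open>@\<close> and \<open>#\<close>, which is what cutting and gluing
  listings requires.\<close>

lemma friendly_iff_successively: "friendly f X \<sigma> \<longleftrightarrow> successively (step_ok f X) \<sigma>"
proof -
  have "sorted (map f \<sigma>) \<longleftrightarrow> successively (\<lambda>a b. f a \<le> f b) \<sigma>"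
    by (simp add: successively_conv_sorted_wrt flip: successively_map[of "(\<le>)" f])
  then show ?thesis
    unfolding friendly_def step_ok_def successively_conv_nth by auto
qed

section \<open>Coefficients of the series\<close>

lemma ex_coloring_of_word:
  assumes "distinct vs" "length w = length vs" "0 \<notin> set w"
  shows "\<exists>f \<in> colorings (set vs). map f vs = w"
proof -
  define f where "f = restrict (\<lambda>x. the (map_of (zip vs w) x)) (set vs)"
  have map: "map f vs = w"
    using assms by (intro nth_equalityI) (auto simp: f_def map_of_zip_nth)
  moreover have "f ` set vs = set w"
    using map by (metis set_map)
  then have "f \<in> colorings (set vs)"
    using assms(3) unfolding colorings_def f_def by (intro PiE_I) fastforce+
  ultimately show ?thesis by blast
qed

text \<open>Since \<open>vs\<close> lists every vertex, the word \<open>map f vs\<close> determines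
  the coloring, so the formal sum has a single term.\<close>

lemma redei_berge_map:
  assumes "set vs = pverts X" "f \<in> colorings (pverts X)"
  shows "redei_berge X vs (map f vs) = int (card (friendly_listings f X))"
proof -
  have "g = f" if "g \<in> colorings (pverts X)" "map g vs = map f vs" for g
  proof (rule PiE_ext)
    show "g \<in> pverts X \<rightarrow>\<^sub>E {0<..}" "f \<in> pverts X \<rightarrow>\<^sub>E {0<..}"
      using that(1) assms(2) by (simp_all add: colorings_def)
    show "g x = f x" if "x \<in> pverts X" for x
      using that \<open>map g vs = map f vs\<close> unfolding assms(1)[symmetric] by simp
  qed
  then have "{g. g \<in> colorings (pverts X) \<and> map g vs = map f vs} = {f}"
    using assms(2) by auto
  then show ?thesis
    by (simp add: redei_berge_def formal_sum_def)
qed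

lemma redei_berge_eq_0:
  assumes "set vs = pverts X" "length w \<noteq> length vs \<or> 0 \<in> set w"
  shows "redei_berge X vs w = 0"
proof -
  have empty: "{g. g \<in> colorings (pverts X) \<and> map g vs = w} = {}"
    using assms by (fastforce simp: colorings_def PiE_iff)
  show ?thesis
    unfolding redei_berge_def formal_sum_def empty by simp
qed

lemma nc_induct_append_last: "xs \<noteq> [] \<Longrightarrow> nc_induct F (xs @ [last xs]) = F xs"
proof -
  assume "xs \<noteq> []"
  then have "{u. u \<in> {u. u \<noteq> []} \<and> u @ [last u] = xs @ [last xs]} = {xs}" by auto
  then show ?thesis by (simp add: nc_induct_def formal_sum_def)
qed

text \<open>Covers two situations at once: \<open>w\<close> does not end in a repeated letter, so
  the premise is vacuous, or the shortened word has coefficient 0.\<close>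

lemma nc_induct_eq_0: "(\<And>xs. xs \<noteq> [] \<Longrightarrow> w = xs @ [last xs] \<Longrightarrow> F xs = 0) \<Longrightarrow> nc_induct F w = 0"
  unfolding nc_induct_def formal_sum_def by (rule sum.neutral) auto

section \<open>Colorings and listings of the contraction\<close>

definition glue_coloring :: "'a set \<Rightarrow> 'a \<times> 'a \<Rightarrow> ('a \<Rightarrow> nat) \<Rightarrow> 'a + 'a \<times> 'a \<Rightarrow> nat" where
  "glue_coloring V e f =
     restrict (case_sum f (\<lambda>_. f (fst e))) (Inl ` (V - {fst e, snd e}) \<union> {Inr e})"

lemma glue_coloring_in_colorings:
  "f \<in> colorings V \<Longrightarrow> fst e \<in> V \<Longrightarrow>
     glue_coloring V e f \<in> colorings (Inl ` (V - {fst e, snd e}) \<union> {Inr e})"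
  by (fastforce simp: colorings_def glue_coloring_def PiE_iff)

lemma pverts_delete_arc [simp]: "pverts (delete_arc X e) = pverts X"
  by (simp add: delete_arc_def)

lemma pverts_contract_arc:
  "pverts (contract_arc X e) = Inl ` (pverts X - {fst e, snd e}) \<union> {Inr e}"
  by (simp add: contract_arc_def Let_def)

lemma step_ok_delete_arc:
  "step_ok f (delete_arc X (u, v)) a b \<longleftrightarrow>
     (if a = u \<and> b = v then f u \<le> f v else step_ok f X a b)"
  by (auto simp: step_ok_def delete_arc_def)

text \<open>The new vertex receives the arcs into \<open>u\<close> and emits the arcs out of
  \<open>v\<close>; as \<open>f u = f v\<close>, its color can stand for either endpoint.\<close>

lemma step_ok_contract_arc:
  fixes X :: "'a pair_pre_digraph"
  assumes "f u = f v"
  defines "V \<equiv> pverts X - {u, v}"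
  defines "S \<equiv> step_ok (glue_coloring (pverts X) (u, v) f) (contract_arc X (u, v))"
  shows "a \<in> V \<Longrightarrow> b \<in> V \<Longrightarrow> S (Inl a) (Inl b) \<longleftrightarrow> step_ok f X a b"
    and "a \<in> V \<Longrightarrow> S (Inl a) (Inr (u, v)) \<longleftrightarrow> step_ok f X a u"
    and "b \<in> V \<Longrightarrow> S (Inr (u, v)) (Inl b) \<longleftrightarrow> step_ok f X v b"
  using assms by (auto simp: step_ok_def contract_arc_def Let_def glue_coloring_def)

lemma friendly_contract_arc_iff:
  assumes "f u = f v" "set as \<subseteq> pverts X - {u, v}" "set bs \<subseteq> pverts X - {u, v}"
  shows "friendly (glue_coloring (pverts X) (u, v) f) (contract_arc X (u, v))
           (map Inl as @ Inr (u, v) # map Inl bs) \<longleftrightarrow>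
         friendly f (delete_arc X (u, v)) (as @ u # v # bs)"
proof -
  let ?S = "step_ok (glue_coloring (pverts X) (u, v) f) (contract_arc X (u, v))"
  let ?D = "step_ok f (delete_arc X (u, v))"
  note S = step_ok_contract_arc[where f = f and u = u and v = v and X = X, OF assms(1)]
  \<comment> \<open>A block avoiding \<open>u\<close> and \<open>v\<close> never uses the deleted
    arc, and contraction leaves its steps unchanged.\<close>
  have inner: "successively ?S (map Inl xs) \<longleftrightarrow> successively ?D xs"
    if "set xs \<subseteq> pverts X - {u, v}" for xs
    unfolding successively_map
    using that by (intro successively_cong) (auto simp: S step_ok_delete_arc subset_iff)
  have "?S (last (map Inl as)) (Inr (u, v)) \<longleftrightarrow> ?D (last as) u" if "as \<noteq> []"
  proof -
    have "last as \<in> pverts X - {u, v}"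
      using that assms(2) last_in_set by blast
    then show ?thesis
      using that by (auto simp: last_map S step_ok_delete_arc)
  qed
  moreover have "?S (Inr (u, v)) (hd (map Inl bs)) \<longleftrightarrow> ?D v (hd bs)" if "bs \<noteq> []"
  proof -
    have "hd bs \<in> pverts X - {u, v}"
      using that assms(3) hd_in_set by blast
    then show ?thesis
      using that by (auto simp: hd_map S step_ok_delete_arc)
  qed
  \<comment> \<open>The only step without a counterpart in the glued listing; it is allowed because
    the arc is gone and the colors agree.\<close>
  moreover have "?D u v"
    using assms(1) by (simp add: step_ok_delete_arc)
  ultimately show ?thesis
    using inner[OF assms(2)] inner[OF assms(3)]
    by (auto simp: friendly_iff_successively successively_append_iff successively_Cons)
qed

section \<open>Counting friendly listings for a fixed coloring\<close>

lemma friendly_listings_subset_delete_arc: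
  "friendly_listings f X \<subseteq> friendly_listings f (delete_arc X e)"
  by (auto simp: friendly_listings_def friendly_def delete_arc_def)

lemma finite_friendly_listings [simp]: "finite (friendly_listings f X)"
  by (simp add: friendly_listings_def)

text \<open>A step that satisfies \<open>P\<close> but violates \<open>Q\<close> can only be
  \<open>(u, v)\<close>. This locates the arc in a listing that becomes friendly only after
  deletion.\<close>

lemma successively_change_pair:
  assumes "successively P xs" "\<not> successively Q xs"
    and "\<And>a b. P a b \<Longrightarrow> (a, b) \<noteq> (u, v) \<Longrightarrow> Q a b"
  shows "\<exists>as bs. xs = as @ u # v # bs \<and> P u v \<and> \<not> Q u v"
  using assms(1,2)
proof (induction xs)
  case (Cons x xs)
  show ?case
  proof (cases "successively Q xs")
    case True
    with Cons.prems assms(3) obtain ys where "x = u" "xs = v # ys" "P u v" "\<not> Q u v"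
      by (cases xs) auto
    then show ?thesis by (metis append_Nil)
  next
    case False
    with Cons obtain as bs where "xs = as @ u # v # bs" "P u v" "\<not> Q u v"
      by (auto simp: successively_Cons split: if_splits)
    then show ?thesis by (metis append_Cons)
  qed
qed simp

text \<open>For distinct colors, \<open>f u \<le> f v\<close> already forces
  \<open>f u < f v\<close>, so the arc adds no constraint.\<close>

lemma friendly_listings_delete_arc_neq:
  assumes "f u \<noteq> f v"
  shows "friendly_listings f (delete_arc X (u, v)) = friendly_listings f X"
proof -
  have "step_ok f (delete_arc X (u, v)) = step_ok f X"
    using assms by (auto simp: fun_eq_iff step_ok_def delete_arc_def le_neq_implies_less)
  then show ?thesis
    by (simp add: friendly_listings_def friendly_iff_successively)
qed

text \<open>The pairs \<open>(as, bs)\<close> of blocks around adjacent \<open>u, v\<close>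
  parametrize both the listings gained by deletion and the friendly listings of the contraction;
  hence both sets have the size of \<open>P\<close>.\<close>

lemma card_friendly_listings_delete_arc:
  assumes "f u = f v" "u \<noteq> v" "(u, v) \<in> parcs X" "u \<in> pverts X" "v \<in> pverts X"
  shows "card (friendly_listings f (delete_arc X (u, v))) =
         card (friendly_listings f X) +
         card (friendly_listings (glue_coloring (pverts X) (u, v) f) (contract_arc X (u, v)))"
proof -
  let ?D = "delete_arc X (u, v)" and ?C = "contract_arc X (u, v)"
  let ?g = "glue_coloring (pverts X) (u, v) f"
  define P where "P = {(as, bs). as @ u # v # bs \<in> friendly_listings f ?D}"
  define split where "split = (\<lambda>(as, bs). as @ u # v # bs)"
  define glue :: "'a list \<times> 'a list \<Rightarrow> ('a + 'a \<times> 'a) list"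
    where "glue = (\<lambda>(as, bs). map Inl as @ Inr (u, v) # map Inl bs)"
  have P_iff: "(as, bs) \<in> P \<longleftrightarrow> distinct as \<and> distinct bs \<and> set as \<inter> set bs = {} \<and>
      set as \<union> set bs = pverts X - {u, v} \<and> friendly f ?D (as @ u # v # bs)" for as bs
    using assms(2,4,5) by (auto simp: P_def friendly_listings_def permutations_of_set_def)

  have "friendly_listings f ?D - friendly_listings f X = split ` P"
  proof (intro equalityI subsetI)
    fix \<sigma> assume "\<sigma> \<in> friendly_listings f ?D - friendly_listings f X"
    then have "\<sigma> \<in> friendly_listings f ?D"
      and "successively (step_ok f ?D) \<sigma>" "\<not> successively (step_ok f X) \<sigma>"
      by (auto simp: friendly_listings_def friendly_iff_successively)
    moreover from this(2,3) obtain as bs where "\<sigma> = as @ u # v # bs"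
      using successively_change_pair[of "step_ok f ?D" \<sigma> "step_ok f X" u v]
      by (auto simp: step_ok_delete_arc)
    ultimately show "\<sigma> \<in> split ` P"
      by (auto simp: P_def split_def)
  next
    fix \<sigma> assume "\<sigma> \<in> split ` P"
    \<comment> \<open>With equal colors, the step from \<open>u\<close> to \<open>v\<close> violates
      the strict increase demanded by the arc in \<open>X\<close>.\<close>
    then show "\<sigma> \<in> friendly_listings f ?D - friendly_listings f X"
      using assms(1,3) by (auto simp: P_def split_def friendly_listings_def
          friendly_iff_successively successively_append_iff step_ok_def)
  qed
  moreover have "inj_on split P"
  proof (rule inj_onI; clarify)
    fix as bs as' bs'
    assume "(as, bs) \<in> P" "(as', bs') \<in> P" "split (as, bs) = split (as', bs')"
    \<comment> \<open>As \<open>u\<close> occurs only once, the place of the cut is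
      determined.\<close>
    then have "u \<notin> set as" "u \<notin> set (v # bs)" "as @ u # v # bs = as' @ u # v # bs'"
      using assms(2) by (auto simp: P_iff split_def)
    then show "as = as' \<and> bs = bs'"
      by (auto simp: append_Cons_eq_iff)
  qed
  ultimately have card_diff:
      "card (friendly_listings f ?D - friendly_listings f X) = card P"
    by (simp add: card_image)

  have "friendly_listings ?g ?C = glue ` P"
  proof (intro equalityI subsetI)
    fix \<tau> assume "\<tau> \<in> friendly_listings ?g ?C"
    then have \<tau>: "distinct \<tau>" "set \<tau> = Inl ` (pverts X - {u, v}) \<union> {Inr (u, v)}" "friendly ?g ?C \<tau>"
      by (auto simp: friendly_listings_def permutations_of_set_def pverts_contract_arc)
    then obtain xs ys where \<tau>_eq: "\<tau> = xs @ Inr (u, v) # ys"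
      by (metis UnI2 singletonI split_list)
    \<comment> \<open>By distinctness the new vertex occurs nowhere else, so both blocks carry only
      the tag \<open>Inl\<close> and come from lists of old vertices.\<close>
    with \<tau>(1) have "set xs \<union> set ys = set \<tau> - {Inr (u, v)}"
      by auto
    then have "set xs \<union> set ys = Inl ` (pverts X - {u, v})"
      unfolding \<tau>(2) by auto
    moreover from this obtain as bs where xs_ys: "xs = map Inl as" "ys = map Inl bs"
      using ex_map_conv[of xs Inl] ex_map_conv[of ys Inl] by blast
    ultimately have "Inl ` (set as \<union> set bs) = (Inl ` (pverts X - {u, v}) :: ('a + 'a \<times> 'a) set)"
      by (simp add: image_Un)
    then have "set as \<union> set bs = pverts X - {u, v}"
      using inj_image_eq_iff[OF inj_Inl] by blast
    moreover from this have "friendly f ?D (as @ u # v # bs)"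
      using \<tau>(3) friendly_contract_arc_iff[of f u v as X bs] assms(1) unfolding \<tau>_eq xs_ys by blast
    ultimately have "(as, bs) \<in> P"
      using \<tau>(1) by (auto simp: P_iff \<tau>_eq xs_ys distinct_map)
    then show "\<tau> \<in> glue ` P"
      unfolding \<tau>_eq xs_ys by (intro image_eqI[of _ glue "(as, bs)"]) (simp_all add: glue_def)
  next
    fix \<tau> assume "\<tau> \<in> glue ` P"
    then obtain as bs where "(as, bs) \<in> P" and \<tau>_eq: "\<tau> = map Inl as @ Inr (u, v) # map Inl bs"
      by (auto simp: glue_def)
    then have P: "distinct as" "distinct bs" "set as \<inter> set bs = {}"
        "set as \<union> set bs = pverts X - {u, v}" "friendly f ?D (as @ u # v # bs)"
      by (simp_all add: P_iff)
    then have "friendly ?g ?C \<tau>"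
      using friendly_contract_arc_iff[of f u v as X bs] assms(1) unfolding \<tau>_eq by blast
    moreover have "distinct \<tau>"
      using P(1-3) by (auto simp: \<tau>_eq distinct_map)
    moreover have "set \<tau> = pverts ?C"
      unfolding pverts_contract_arc fst_conv snd_conv P(4)[symmetric] by (auto simp: \<tau>_eq)
    ultimately show "\<tau> \<in> friendly_listings ?g ?C"
      by (simp add: friendly_listings_def permutations_of_set_def)
  qed
  moreover have "inj_on glue P"
  proof (rule inj_onI; clarify)
    fix as bs as' bs'
    assume "glue (as, bs) = glue (as', bs')"
    moreover have "Inr (u, v) \<notin> set (map Inl as)" "Inr (u, v) \<notin> set (map Inl bs)"
      by auto
    ultimately have "map Inl as = (map Inl as' :: ('a + 'a \<times> 'a) list)"
      "map Inl bs = (map Inl bs' :: ('a + 'a \<times> 'a) list)"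
      by (auto simp: glue_def append_Cons_eq_iff)
    then show "as = as' \<and> bs = bs'"
      by (simp add: inj_map_eq_map)
  qed
  ultimately have "card (friendly_listings ?g ?C) = card P"
    by (simp add: card_image)
  with card_diff show ?thesis
    using friendly_listings_subset_delete_arc[of f X "(u, v)"]
    by (metis card_Diff_subset card_mono finite_friendly_listings le_add_diff_inverse)
qed

section \<open>Comparison of coefficients\<close>

theorem theorem3p7:
  fixes X :: "'a pair_pre_digraph" and us :: "'a list" and u v :: 'a
  assumes "pair_fin_digraph X"
    and "us @ [u, v] \<in> permutations_of_set (pverts X)"
    and "(u, v) \<in> parcs X"
  shows "redei_berge X (us @ [u, v]) =
           redei_berge (delete_arc X (u, v)) (us @ [u, v])
           - nc_induct (redei_berge (contract_arc X (u, v)) (map Inl us @ [Inr (u, v)]))"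
proof (rule ext)
  fix w
  let ?vs = "us @ [u, v]" and ?cs = "map Inl us @ [Inr (u, v)]"
  let ?D = "delete_arc X (u, v)" and ?C = "contract_arc X (u, v)"
  have dist: "distinct ?vs" and set_vs: "set ?vs = pverts X"
    using assms(2) by (simp_all add: permutations_of_set_def)
  have uv: "u \<noteq> v" "u \<in> pverts X" "v \<in> pverts X" and set_us: "set us = pverts X - {u, v}"
    using dist unfolding set_vs[symmetric] by auto
  have set_cs: "set ?cs = pverts ?C"
    using set_us by (simp add: pverts_contract_arc)
  have "redei_berge X ?vs w = redei_berge ?D ?vs w - nc_induct (redei_berge ?C ?cs) w"
  proof (cases "length w = length ?vs \<and> 0 \<notin> set w")
    case False
    have "nc_induct (redei_berge ?C ?cs) w = 0"
    proof (rule nc_induct_eq_0)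
      fix xs :: "nat list"
      assume "xs \<noteq> []" "w = xs @ [last xs]"
      \<comment> \<open>Dropping the repeated last letter loses no letter from the set of letters,
        so a 0 in \<open>w\<close> is also in \<open>xs\<close>; both lengths fall by one, as from
        \<open>?vs\<close> to \<open>?cs\<close>.\<close>
      with False have "length xs \<noteq> length ?cs \<or> 0 \<in> set xs"
        by (auto dest: last_in_set)
      then show "redei_berge ?C ?cs xs = 0"
        using set_cs by (rule redei_berge_eq_0[rotated])
    qed
    moreover have "redei_berge X ?vs w = 0" "redei_berge ?D ?vs w = 0"
      using redei_berge_eq_0[of ?vs X w] redei_berge_eq_0[of ?vs ?D w] False set_vs
      unfolding pverts_delete_arc by blast+
    ultimately show ?thesis by simp
  next
    case True
    \<comment> \<open>The remaining words are exactly those read off from a coloring, since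
      \<open>?vs\<close> has no repetitions.\<close>
    then obtain f where f: "f \<in> colorings (pverts X)" and w: "w = map f ?vs"
      using ex_coloring_of_word[OF dist, of w] set_vs by auto
    have X: "redei_berge X ?vs w = int (card (friendly_listings f X))"
      unfolding w using set_vs f by (rule redei_berge_map)
    have D: "redei_berge ?D ?vs w = int (card (friendly_listings f ?D))"
      unfolding w using set_vs f by (intro redei_berge_map) auto
    show ?thesis
    proof (cases "f u = f v")
      case True
      let ?g = "glue_coloring (pverts X) (u, v) f"
      have map_g: "map ?g ?cs = map f us @ [f u]"
        using set_us by (auto simp: glue_coloring_def)
      \<comment> \<open>The last letter \<open>f v\<close> of \<open>w\<close> equals
        \<open>f u\<close>, the color of the new vertex, so induction restores it.\<close>
      have "w = map ?g ?cs @ [last (map ?g ?cs)]"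
        unfolding w map_g using True by simp
      then have "nc_induct (redei_berge ?C ?cs) w = redei_berge ?C ?cs (map ?g ?cs)"
        using nc_induct_append_last[of "map ?g ?cs"] by simp
      also have "\<dots> = int (card (friendly_listings ?g ?C))"
        using set_cs glue_coloring_in_colorings[OF f, of "(u, v)"] uv
        by (intro redei_berge_map) (simp_all add: pverts_contract_arc)
      finally show ?thesis
        using card_friendly_listings_delete_arc[OF True uv(1) assms(3) uv(2,3)] X D by simp
    next
      case False
      \<comment> \<open>The last two letters differ, so no word induces to \<open>w\<close>.\<close>
      have "w = (map f us @ [f u]) @ [f v]"
        unfolding w by simp
      with False have "nc_induct (redei_berge ?C ?cs) w = 0"
        by (intro nc_induct_eq_0) (auto simp del: append_assoc)
      then show ?thesis
        using X D friendly_listings_delete_arc_neq[of f u v X] False by simp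
    qed
  qed
  then show "redei_berge X ?vs w =
      (redei_berge ?D ?vs - nc_induct (redei_berge ?C ?cs)) w"
    by simp
qed

end
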